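(* Let $n,m\ge 1$, $M=\{1,\dots,m\}$, and for $0\le k\le m$ let $q_k(u)=u^TA_ku+2b_k^Tu+c_k$ ($u\in\mathbb{R}^n$), where $A_k$ is a real symmetric $n\times n$ matrix, $b_k\in\mathbb{R}^n$, $c_k\in\mathbb{R}$ and $c_0=0$. Let $\zeta$, $\eta_p$, $\eta_d$, $\varphi$ be the optimal values of the QCQP, of its primal SDP relaxation, of its dual SDP relaxation and of its Lagrangian dual, and let $L$ be the Lagrangian function and $G=\{y\in\mathbb{R}^m: y_k\ge 0\ (k\in M)\}$ (all as defined in the context). Consider the conditions: (A) There exists a saddle point of $L$, i.e. a $(u,y)\in\mathbb{R}^n\times G$ with $\sup_{y'\in G}L(u,y')=L(u,y)=\inf_{u'\in\mathbb{R}^n}L(u',y)$. (B) The primal SDP relaxation is exact, the dual SDP relaxation has an optimal solution $(y,s)$, and $\eta_d=\eta_p$. (C) The primal SDP relaxation is exact. (D) $-\infty<\eta_p=\zeta<\infty$. (E) $-\infty<\eta_d=\zeta<\infty$. (F) $-\infty<\varphi=\zeta<\infty$. Consider also the assumptions: (a) The (generalized) Slater constraint qualification holds: there is a positive definite $X\in\widetilde F$ such that $Q_k\bullet X<0$ for all $k\in\widetilde M^-$. (b) If $\zeta$ is finite, then the QCQP has a (global) minimizer. Then the following hold: 1. (A) $\Leftrightarrow$ (B). 2. (B) $\Rightarrow$ (C); and if (a) holds, then (C) $\Rightarrow$ (B). 3. (C) $\Rightarrow$ (D); and if (b) holds, then (D) $\Rightarrow$ (C). 4. (E) $\Rightarrow$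 (D); and if (B) holds, then (D) $\Rightarrow$ (E). 5. (E) $\Leftrightarrow$ (F). Consequently, if both (a) and (b) hold, then (A), (B), (C), (D), (E) and (F) are all equivalent.
   Context: Let $\mathbb{S}^{\ell}$ be the space of real symmetric $\ell\times\ell$ matrices and $\mathbb{S}^{\ell}_+$ the cone of positive semidefinite matrices in it. Matrices in $\mathbb{S}^{1+n}$ have row and column indices $0,1,\dots,n$, and $Q\bullet X=\sum_{i,j}Q_{ij}X_{ij}$. Infima and suprema take values in $[-\infty,+\infty]$, with $\inf\emptyset=+\infty$ and $\sup\emptyset=-\infty$. QCQP: $\zeta=\inf\{q_0(u): u\in\mathbb{R}^n,\ q_k(u)\le 0\ (k\in M)\}$. A (global) minimizer is a feasible $u$ with $q_0(u)\le q_0(u')$ for all feasible $u'$. Lagrangian function: $L(u,y)=q_0(u)+\sum_{k\in M}y_kq_k(u)$ for $(u,y)\in\mathbb{R}^n\times\mathbb{R}^m$. Lagrangian dual: $\varphi=\sup_{y\in G}\inf\{L(u,y):u\in\mathbb{R}^n\}$. Data matrices: $Q_k=\begin{pmatrix} c_k & b_k^T \\ b_k & A_k \end{pmatrix}\in\mathbb{S}^{1+n}$ ($0\le k\le m$), and $H\in\mathbb{S}^{1+n}$ is the matrix with $H_{00}=1$ and all other entries $0$. Let $\widetilde F=\{X\in\mathbb{S}^{1+n}: Q_k\bullet X\le 0\ (k\in M),\ H\bullet X=1\}$. Primal SDP relaxation: $\eta_p=\inf\{Q_0\bullet X: X\in\mathbb{S}^{1+n}_+,\ X\in\widetilde F\}$.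 Dual SDP relaxation: $\eta_d=\sup\{s: Q_0+\sum_{k\in M}y_kQ_k-sH\in\mathbb{S}^{1+n}_+,\ y\in G,\ s\in\mathbb{R}\}$. The primal SDP relaxation is called exact if it has a rank-1 optimal solution, i.e. an optimal solution of the form $X=\begin{pmatrix} 1 \\ u \end{pmatrix}\begin{pmatrix} 1 \\ u \end{pmatrix}^T$ with $u\in\mathbb{R}^n$ (such a $u$ is then a global minimizer of the QCQP). $\widetilde M^-=\{k\in M: \text{there is } X\in\mathbb{S}^{1+n}_+\cap\widetilde F \text{ with } Q_k\bullet X<0\}$. *)

theory Defs
  imports "HOL-Analysis.Analysis"
begin

text \<open>
  The ground types are \<open>'n\<close> for the coordinates $1,\dots,n$ and \<open>'m\<close> for the index set $M$.
  The index ranges $0,\dots,n$ and $0,\dots,m$ are the types \<open>'n option\<close> and \<open>'m option\<close>,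
  with \<open>None\<close> in the role of the index $0$. Problem data are families over \<open>'m option\<close>:
  the objective sits at \<open>None\<close>, the constraints at \<open>Some k\<close>.
  All optimal values are extended reals, so that the infimum over the empty set is \<open>\<infinity>\<close> and
  the supremum over it is \<open>-\<infinity>\<close>.
\<close>

subsection \<open>Symmetric and semidefinite matrices\<close>

definition sym_mat :: "real^'a^'a \<Rightarrow> bool" where
  "sym_mat X \<longleftrightarrow> transpose X = X"

definition psd :: "real^'a^'a \<Rightarrow> bool" where
  "psd X \<longleftrightarrow> sym_mat X \<and> (\<forall>v. 0 \<le> v \<bullet> (X *v v))"

definition pos_def :: "real^'a^'a \<Rightarrow> bool" where
  "pos_def X \<longleftrightarrow> sym_mat X \<and> (\<forall>v. v \<noteq> 0 \<longrightarrow> 0 < v \<bullet> (X *v v))"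

subsection \<open>The QCQP and its Lagrangian dual\<close>

definition quad_fun :: "real^'n^'n \<Rightarrow> real^'n \<Rightarrow> real \<Rightarrow> real^'n \<Rightarrow> real" where
  "quad_fun A b c u = u \<bullet> (A *v u) + 2 * (b \<bullet> u) + c"

definition qcqp_feasible :: "('m option \<Rightarrow> real^'n \<Rightarrow> real) \<Rightarrow> (real^'n) set" where
  "qcqp_feasible q = {u. \<forall>k. q (Some k) u \<le> 0}"

definition qcqp_value :: "('m option \<Rightarrow> real^'n \<Rightarrow> real) \<Rightarrow> ereal" where
  "qcqp_value q = (INF u\<in>qcqp_feasible q. ereal (q None u))"

definition qcqp_minimizer :: "('m option \<Rightarrow> real^'n \<Rightarrow> real) \<Rightarrow> real^'n \<Rightarrow> bool" where
  "qcqp_minimizer q u \<longleftrightarrow>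
     u \<in> qcqp_feasible q \<and> (\<forall>u'\<in>qcqp_feasible q. q None u \<le> q None u')"

definition lagrangian ::
  "('m::finite option \<Rightarrow> real^'n \<Rightarrow> real) \<Rightarrow> real^'n \<Rightarrow> real^'m \<Rightarrow> real" where
  "lagrangian q u y = q None u + (\<Sum>k\<in>UNIV. y $ k * q (Some k) u)"

definition nonneg_multipliers :: "(real^'m) set" where
  "nonneg_multipliers = {y. \<forall>k. 0 \<le> y $ k}"

definition lagrangian_dual_value :: "('m::finite option \<Rightarrow> real^'n \<Rightarrow> real) \<Rightarrow> ereal" where
  "lagrangian_dual_value q =
     (SUP y\<in>nonneg_multipliers. INF u. ereal (lagrangian q u y))"

definition saddle_point ::
  "('m::finite option \<Rightarrow> real^'n \<Rightarrow> real) \<Rightarrow> real^'n \<Rightarrow> real^'m \<Rightarrow> bool" where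
  "saddle_point q u y \<longleftrightarrow>
     y \<in> nonneg_multipliers \<and>
     (SUP y'\<in>nonneg_multipliers. ereal (lagrangian q u y')) = ereal (lagrangian q u y) \<and>
     ereal (lagrangian q u y) = (INF u'. ereal (lagrangian q u' y))"

subsection \<open>The SDP relaxations\<close>

definition data_matrix ::
  "real^'n::finite^'n \<Rightarrow> real^'n \<Rightarrow> real \<Rightarrow> real^('n option)^('n option)" where
  "data_matrix A b c = (\<chi> i j.
     case (i, j) of
       (None, None) \<Rightarrow> c
     | (None, Some l) \<Rightarrow> b $ l
     | (Some k, None) \<Rightarrow> b $ k
     | (Some k, Some l) \<Rightarrow> A $ k $ l)"

definition H_mat :: "real^('n::finite option)^('n option)" where
  "H_mat = (\<chi> i j. if i = None \<and> j = None then 1 else 0)"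

text \<open>The inner product of the matrix space is $Q \bullet X = \sum_{i,j} Q_{ij} X_{ij}$.\<close>

definition F_tilde ::
  "('m option \<Rightarrow> real^('n::finite option)^('n option)) \<Rightarrow> (real^('n option)^('n option)) set" where
  "F_tilde Q = {X. sym_mat X \<and> (\<forall>k. Q (Some k) \<bullet> X \<le> 0) \<and> H_mat \<bullet> X = 1}"

definition primal_feasible ::
  "('m option \<Rightarrow> real^('n::finite option)^('n option)) \<Rightarrow> (real^('n option)^('n option)) set" where
  "primal_feasible Q = {X. psd X} \<inter> F_tilde Q"

definition primal_value :: "('m option \<Rightarrow> real^('n::finite option)^('n option)) \<Rightarrow> ereal" where
  "primal_value Q = (INF X\<in>primal_feasible Q. ereal (Q None \<bullet> X))"

definition primal_optimal ::
  "('m option \<Rightarrow> real^('n::finite option)^('n option)) \<Rightarrow> real^('n option)^('n option) \<Rightarrow> bool" where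
  "primal_optimal Q X \<longleftrightarrow>
     X \<in> primal_feasible Q \<and> (\<forall>X'\<in>primal_feasible Q. Q None \<bullet> X \<le> Q None \<bullet> X')"

definition homogenize :: "real^'n::finite \<Rightarrow> real^('n option)" where
  "homogenize u = (\<chi> i. case i of None \<Rightarrow> 1 | Some k \<Rightarrow> u $ k)"

definition rank_one_lift :: "real^'n::finite \<Rightarrow> real^('n option)^('n option)" where
  "rank_one_lift u = (\<chi> i j. homogenize u $ i * homogenize u $ j)"

definition primal_exact :: "('m option \<Rightarrow> real^('n::finite option)^('n option)) \<Rightarrow> bool" where
  "primal_exact Q \<longleftrightarrow> (\<exists>X. primal_optimal Q X \<and> (\<exists>u. X = rank_one_lift u))"

definition dual_feasible ::
  "('m::finite option \<Rightarrow> real^('n::finite option)^('n option)) \<Rightarrow> ((real^'m) \<times> real) set" where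
  "dual_feasible Q =
     {(y, s). y \<in> nonneg_multipliers \<and>
        psd (Q None + (\<Sum>k\<in>UNIV. y $ k *\<^sub>R Q (Some k)) - s *\<^sub>R H_mat)}"

definition dual_value ::
  "('m::finite option \<Rightarrow> real^('n::finite option)^('n option)) \<Rightarrow> ereal" where
  "dual_value Q = (SUP (y, s)\<in>dual_feasible Q. ereal s)"

definition dual_optimal ::
  "('m::finite option \<Rightarrow> real^('n::finite option)^('n option)) \<Rightarrow> real^'m \<Rightarrow> real \<Rightarrow> bool" where
  "dual_optimal Q y s \<longleftrightarrow>
     (y, s) \<in> dual_feasible Q \<and> (\<forall>(y', s')\<in>dual_feasible Q. s' \<le> s)"

definition M_minus :: "('m option \<Rightarrow> real^('n::finite option)^('n option)) \<Rightarrow> 'm set" where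
  "M_minus Q = {k. \<exists>X. psd X \<and> X \<in> F_tilde Q \<and> Q (Some k) \<bullet> X < 0}"

definition generalized_slater :: "('m option \<Rightarrow> real^('n::finite option)^('n option)) \<Rightarrow> bool" where
  "generalized_slater Q \<longleftrightarrow>
     (\<exists>X\<in>F_tilde Q. pos_def X \<and> (\<forall>k\<in>M_minus Q. Q (Some k) \<bullet> X < 0))"

end

theory Submission
  imports Defs
begin

text \<open>
  Everything rests on reading a quadratic function as a linear one:
  \<open>q k u = Q k \<bullet> X\<close> for the rank-one matrix \<open>X\<close> built from \<open>(1, u)\<close>.  Points of the QCQP
  are thereby the rank-one points of the primal relaxation, so \<open>\<eta>p \<le> \<zeta>\<close>.  On the dual
  side, a quadratic function is nonnegative everywhere iff its matrix is semidefinite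
  (\<open>psd_iff_nonneg_homogenize\<close>); hence \<open>(y, s)\<close> is feasible for the dual relaxation iff
  \<open>s\<close> is a lower bound of \<open>L(\<cdot>, y)\<close>.  This gives \<open>\<eta>d = \<phi>\<close>, that is (E) \<open>\<longleftrightarrow>\<close> (F), and it
  turns a saddle point into a feasible \<open>u\<close> together with a dual feasible \<open>(y, q None u)\<close>
  (\<open>saddle_point_iff\<close>).  By weak duality such a pair is the same thing as an optimal
  rank-one matrix and an optimal dual point with equal values, which is (A) \<open>\<longleftrightarrow>\<close> (B).
  The relations among (C), (D) and (E) follow from \<open>\<eta>d \<le> \<eta>p \<le> \<zeta>\<close>, the first inequality
  being weak duality: the inner product of two semidefinite matrices is nonnegative
  (\<open>psd_inner_nonneg\<close>).

  The implication from (C) to (B) under the Slater condition is strong duality with an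
  attained dual (\<open>strong_duality\<close>).  It suffices that the linear inequalities
  \<open>Q k \<bullet> X \<le> 0\<close> have a common solution in the interior of a convex cone: separating the cone
  from the polyhedral set on which the objective falls below its optimal value, and
  resolving the separating functional by the Farkas lemma, yields the multipliers
  (\<open>conic_multipliers\<close>).
\<close>

section \<open>Quadratic forms as inner products with rank-one matrices\<close>

definition outer :: "real^'a \<Rightarrow> real^'a^'a" where
  "outer v = (\<chi> i j. v $ i * v $ j)"

lemma quadratic_form_eq_inner_outer:
  fixes X :: "real^'a::finite^'a"
  shows "v \<bullet> (X *v v) = X \<bullet> outer v"
  by (simp add: inner_vec_def outer_def matrix_vector_mult_def sum_distrib_left mult_ac)

lemma psd_iff: "psd X \<longleftrightarrow> sym_mat X \<and> (\<forall>v. 0 \<le> X \<bullet> outer v)"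
  by (simp add: psd_def quadratic_form_eq_inner_outer)

lemma pos_def_iff: "pos_def X \<longleftrightarrow> sym_mat X \<and> (\<forall>v. v \<noteq> 0 \<longrightarrow> 0 < X \<bullet> outer v)"
  by (simp add: pos_def_def quadratic_form_eq_inner_outer)

lemma sym_mat_iff: "sym_mat X \<longleftrightarrow> (\<forall>i j. X $ i $ j = X $ j $ i)"
  by (auto simp: sym_mat_def transpose_def vec_eq_iff)

lemma outer_scaleR: "outer (t *\<^sub>R v) = t\<^sup>2 *\<^sub>R outer v"
  by (simp add: outer_def vec_eq_iff power2_eq_square)

lemma sym_mat_outer: "sym_mat (outer v)"
  by (simp add: sym_mat_iff outer_def)

lemma inner_outer_outer: "outer v \<bullet> outer w = (v \<bullet> w)\<^sup>2"
  by (simp add: inner_vec_def outer_def power2_eq_square sum_product mult_ac)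

lemma psd_outer: "psd (outer v)"
  by (simp add: psd_iff sym_mat_outer inner_outer_outer)

lemma norm_outer: "norm (outer v) = (norm v)\<^sup>2"
  by (simp add: norm_eq_sqrt_inner inner_outer_outer)

lemma inner_outer_add:
  fixes X :: "real^'a::finite^'a"
  assumes "sym_mat X"
  shows "X \<bullet> outer (v + t *\<^sub>R w) = X \<bullet> outer v + 2 * t * (w \<bullet> (X *v v)) + t\<^sup>2 * (X \<bullet> outer w)"
proof -
  have "w \<bullet> (X *v v) = v \<bullet> (X *v w)"
    using assms by (metis sym_mat_def dot_lmul_matrix inner_commute transpose_matrix_vector)
  then show ?thesis
    by (simp add: quadratic_form_eq_inner_outer[symmetric] matrix_vector_right_distrib
        matrix_vector_mult_scaleR inner_simps algebra_simps power2_eq_square)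
qed

lemma inner_outer_axis:
  fixes X :: "real^'a::finite^'a"
  shows "X \<bullet> outer (axis i 1) = X $ i $ i"
  by (simp add: quadratic_form_eq_inner_outer[symmetric] inner_axis' matrix_vector_mul_component
      inner_axis)

section \<open>Inner products of semidefinite matrices\<close>

lemma psd_zero_diagonal:
  fixes X :: "real^'a::finite^'a"
  assumes "psd X" "\<And>i. X $ i $ i = 0"
  shows "X = 0"
proof -
  have "X $ i $ j = 0" for i j
  proof -
    have "0 \<le> X \<bullet> outer (axis j 1 + t *\<^sub>R axis i 1)" for t
      using assms(1) by (simp add: psd_iff)
    then have "0 \<le> 2 * t * X $ i $ j" for t
      using assms by (simp add: inner_outer_add psd_iff inner_outer_axis inner_axis'
          matrix_vector_mul_component inner_axis)
    from this[of 1] this[of "-1"] show ?thesis by simp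
  qed
  then show ?thesis by (simp add: vec_eq_iff)
qed

text \<open>
  One step of the Cholesky decomposition.  Completing the square along the
  coordinate \<open>i\<close> shows that the value of the new form at \<open>v\<close> is the value of the old one at a
  shifted vector.
\<close>
lemma psd_cholesky_step:
  fixes X :: "real^'a::finite^'a"
  assumes "psd X" "X $ i $ i \<noteq> 0"
  shows "psd (X - (1 / X $ i $ i) *\<^sub>R outer (X *v axis i 1))"
proof -
  let ?e = "axis i 1 :: real^'a" and ?d = "X $ i $ i"
  have sym: "sym_mat X" using assms by (simp add: psd_iff)
  have "0 \<le> (X - (1 / ?d) *\<^sub>R outer (X *v ?e)) \<bullet> outer v" for v
  proof -
    let ?p = "?e \<bullet> (X *v v)"
    have p: "(X *v ?e) \<bullet> v = ?p"
      using sym by (metis sym_mat_def dot_lmul_matrix inner_commute transpose_matrix_vector)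
    have "0 \<le> X \<bullet> outer (v + (- ?p / ?d) *\<^sub>R ?e)"
      using assms(1) by (simp add: psd_iff)
    also have "\<dots> = X \<bullet> outer v - ?p\<^sup>2 / ?d"
      using assms(2) unfolding inner_outer_add[OF sym] inner_outer_axis
      by (simp add: field_simps power2_eq_square)
    also have "\<dots> = (X - (1 / ?d) *\<^sub>R outer (X *v ?e)) \<bullet> outer v"
      by (simp add: inner_diff_left inner_outer_outer p)
    finally show ?thesis .
  qed
  moreover have "sym_mat (X - (1 / ?d) *\<^sub>R outer (X *v ?e))"
    using sym sym_mat_outer[of "X *v ?e"] by (simp add: sym_mat_iff)
  ultimately show ?thesis by (simp add: psd_iff)
qed

text \<open>
  Peeling off rank-one terms by Cholesky steps writes \<open>X\<close> as a nonnegative combination of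
  matrices \<open>outer w\<close>, and \<open>Y\<close> is nonnegative on each of them.  The induction is on the
  number of nonzero diagonal entries: a step clears the chosen one, and a zero diagonal entry
  can only decrease, hence stays zero by semidefiniteness.
\<close>
lemma psd_inner_nonneg:
  fixes X Y :: "real^'a::finite^'a"
  assumes "psd Y" "psd X"
  shows "0 \<le> Y \<bullet> X"
  using assms(2)
proof (induction "card {i. X $ i $ i \<noteq> 0}" arbitrary: X rule: less_induct)
  case less
  show ?case
  proof (cases "\<forall>i. X $ i $ i = 0")
    case True
    with psd_zero_diagonal less.prems have "X = 0" by blast
    then show ?thesis by simp
  next
    case False
    then obtain i where i: "X $ i $ i \<noteq> 0" by blast
    let ?w = "X *v axis i 1" and ?d = "X $ i $ i"
    define X' where "X' = X - (1 / ?d) *\<^sub>R outer ?w"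
    have diag: "0 \<le> Z $ j $ j" if "psd Z" for Z :: "real^'a^'a" and j
      using that inner_outer_axis[of Z j] by (metis psd_iff)
    have d: "0 < ?d" using diag[OF less.prems, of i] i by simp
    have psd': "psd X'"
      unfolding X'_def by (rule psd_cholesky_step[OF less.prems i])
    have w: "?w $ j = X $ j $ i" for j
      by (simp add: matrix_vector_mul_component inner_axis)
    have "X' $ i $ i = 0"
      using i by (simp add: X'_def outer_def w)
    moreover have "X' $ j $ j = 0" if "X $ j $ j = 0" for j
    proof -
      have "X' $ j $ j \<le> 0"
        using that d by (simp add: X'_def outer_def)
      with diag[OF psd', of j] show ?thesis by simp
    qed
    ultimately have "{j. X' $ j $ j \<noteq> 0} \<subset> {j. X $ j $ j \<noteq> 0}"
      using i by blast
    then have "card {j. X' $ j $ j \<noteq> 0} < card {j. X $ j $ j \<noteq> 0}"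
      by (intro psubset_card_mono) auto
    then have "0 \<le> Y \<bullet> X'" using less.hyps psd' by blast
    moreover have "0 \<le> (1 / ?d) * (Y \<bullet> outer ?w)"
      using d assms(1) by (simp add: psd_iff)
    ultimately show ?thesis by (simp add: X'_def inner_diff_right)
  qed
qed

section \<open>A theorem of the alternative for a convex cone and finitely many inequalities\<close>

text \<open>
  A vector outside the cone generated by the \<open>Q i\<close> could be separated from it, because a
  finitely generated cone is closed; the normal of the hyperplane would violate the
  assumption.
\<close>
lemma farkas:
  fixes Q :: "'i::finite \<Rightarrow> 'a::euclidean_space"
  assumes "\<And>x. (\<And>i. Q i \<bullet> x \<le> 0) \<Longrightarrow> a \<bullet> x \<le> 0"
  obtains \<mu> where "\<And>i. 0 \<le> \<mu> i" "a = (\<Sum>i\<in>UNIV. \<mu> i *\<^sub>R Q i)"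
proof -
  define C where "C = convex_cone hull (range Q)"
  have "a \<in> C"
  proof (rule ccontr)
    assume "a \<notin> C"
    moreover have "convex C" "closed C"
      by (simp_all add: C_def convex_convex_cone_hull closed_convex_cone_hull)
    ultimately obtain z \<beta> where z: "z \<bullet> a < \<beta>" "\<And>x. x \<in> C \<Longrightarrow> \<beta> < z \<bullet> x"
      using separating_hyperplane_closed_point by metis
    have \<beta>: "\<beta> < 0"
      using z(2)[of 0] by (simp add: C_def convex_cone_hull_contains_0)
    have "0 \<le> z \<bullet> Q i" for i
    proof (rule ccontr)
      assume neg: "\<not> 0 \<le> z \<bullet> Q i"
      have "(\<beta> / (z \<bullet> Q i)) *\<^sub>R Q i \<in> C"
        using \<beta> neg unfolding C_def
        by (intro convex_cone_hull_mul hull_inc) (auto simp: divide_nonpos_neg)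
      from z(2)[OF this] neg show False by simp
    qed
    then have "a \<bullet> (- z) \<le> 0"
      by (intro assms) (simp add: inner_commute)
    with z(1) \<beta> show False by (simp add: inner_commute)
  qed
  moreover have "C \<subseteq> {\<Sum>i\<in>UNIV. \<mu> i *\<^sub>R Q i | \<mu>. \<forall>i. 0 \<le> \<mu> i}" (is "_ \<subseteq> ?S")
    unfolding C_def
  proof (rule hull_minimal)
    show "range Q \<subseteq> ?S"
    proof clarify
      fix i
      show "\<exists>\<mu>. Q i = (\<Sum>j\<in>UNIV. \<mu> j *\<^sub>R Q j) \<and> (\<forall>j. 0 \<le> \<mu> j)"
        by (rule exI[of _ "\<lambda>j. if j = i then 1 else 0"]) (simp add: if_distrib[of "\<lambda>t. t *\<^sub>R _"] cong: if_cong)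
    qed
    show "convex_cone ?S"
      unfolding convex_cone_iff
    proof (intro conjI ballI allI impI)
      show "0 \<in> ?S" by (auto intro!: exI[of _ "\<lambda>_. 0"])
      fix x assume "x \<in> ?S"
      then obtain \<mu> where \<mu>: "x = (\<Sum>i\<in>UNIV. \<mu> i *\<^sub>R Q i)" "\<forall>i. 0 \<le> \<mu> i" by blast
      show "t *\<^sub>R x \<in> ?S" if "0 \<le> t" for t
        using \<mu> that by (auto intro!: exI[of _ "\<lambda>i. t * \<mu> i"] simp: scaleR_sum_right)
      fix y assume "y \<in> ?S"
      then obtain \<nu> where "y = (\<Sum>i\<in>UNIV. \<nu> i *\<^sub>R Q i)" "\<forall>i. 0 \<le> \<nu> i" by blast
      with \<mu> show "x + y \<in> ?S"
        by (auto intro!: exI[of _ "\<lambda>i. \<mu> i + \<nu> i"] simp: sum.distrib scaleR_add_left)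
    qed
  qed
  ultimately show ?thesis using that by blast
qed

lemma sum_UNIV_option:
  "(\<Sum>i\<in>UNIV. f i) = f None + (\<Sum>k\<in>UNIV. f (Some k))" for f :: "'i::finite option \<Rightarrow> 'b::comm_monoid_add"
  by (simp add: UNIV_option_conv sum.reindex inj_on_def)

text \<open>A step from an interior point against the direction \<open>a\<close> stays in \<open>K\<close>.\<close>
lemma inner_pos_of_interior:
  fixes a :: "'a::euclidean_space"
  assumes "x0 \<in> interior K" "a \<noteq> 0" "\<And>x. x \<in> K \<Longrightarrow> 0 \<le> a \<bullet> x"
  shows "0 < a \<bullet> x0"
proof -
  obtain e where e: "0 < e" "cball x0 e \<subseteq> K"
    using assms(1) mem_interior_cball by blast
  have "x0 - (e / norm a) *\<^sub>R a \<in> K"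
    using e assms(2) by (intro subsetD[OF e(2)]) (simp add: dist_norm)
  from assms(3)[OF this] have "(e / norm a) * (a \<bullet> a) \<le> a \<bullet> x0"
    by (simp add: inner_diff_right)
  moreover have "0 < (e / norm a) * (a \<bullet> a)"
    using e(1) assms(2) by simp
  ultimately show ?thesis by linarith
qed

text \<open>
  Lagrange multipliers exist for linear constraints over a convex cone as soon as a feasible
  point lies in the interior of the cone.  The part \<open>N\<close> of the polyhedral cone where \<open>c\<close> is
  negative is disjoint from \<open>K\<close>.  If it is empty, the Farkas lemma applies to \<open>- c\<close>.
  Otherwise a hyperplane separates: some \<open>a \<noteq> 0\<close> is nonnegative on \<open>K\<close> and nonpositive
  on \<open>N\<close>, and the Farkas lemma writes \<open>a\<close> as a nonnegative combination of \<open>c\<close> and the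
  \<open>Q k\<close>.  The coefficient of \<open>c\<close> is positive, since otherwise \<open>a\<close> would be nonpositive
  at the interior point.  Dividing by it gives the multipliers.
\<close>
lemma conic_multipliers:
  fixes Q :: "'i::finite \<Rightarrow> 'a::euclidean_space" and K :: "'a set"
  assumes K: "convex_cone K"
    and x0: "x0 \<in> interior K" "\<And>k. Q k \<bullet> x0 \<le> 0"
    and nonneg: "\<And>x. x \<in> K \<Longrightarrow> (\<And>k. Q k \<bullet> x \<le> 0) \<Longrightarrow> 0 \<le> c \<bullet> x"
  obtains \<mu> where "\<And>k. 0 \<le> \<mu> k" "\<And>x. x \<in> K \<Longrightarrow> 0 \<le> (c + (\<Sum>k\<in>UNIV. \<mu> k *\<^sub>R Q k)) \<bullet> x"
proof (cases "\<forall>x. (\<forall>k. Q k \<bullet> x \<le> 0) \<longrightarrow> 0 \<le> c \<bullet> x")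
  case True
  then obtain \<mu> where "\<And>k. 0 \<le> \<mu> k" "- c = (\<Sum>k\<in>UNIV. \<mu> k *\<^sub>R Q k)"
    using farkas[of Q "- c"] by (metis inner_minus_left neg_le_0_iff_le)
  then show ?thesis using that[of \<mu>] by (metis add.right_inverse inner_zero_left order_refl)
next
  case False
  define N where "N = {x. (\<forall>k. Q k \<bullet> x \<le> 0) \<and> c \<bullet> x < 0}"
  obtain z where z: "z \<in> N" using False by (auto simp: N_def not_le)
  have "convex N"
  proof -
    have "N = (\<Inter>k. {x. Q k \<bullet> x \<le> 0}) \<inter> {x. c \<bullet> x < 0}" by (auto simp: N_def)
    then show ?thesis by (simp add: convex_INT convex_Int convex_halfspace_le convex_halfspace_lt)
  qed
  moreover have "K \<inter> N = {}" using nonneg by (force simp: N_def)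
  moreover have "convex K" "K \<noteq> {}" using K by (auto simp: convex_cone_def)
  ultimately obtain a \<beta> where a: "a \<noteq> 0" "\<forall>x\<in>N. a \<bullet> x \<le> \<beta>" "\<forall>x\<in>K. \<beta> \<le> a \<bullet> x"
    using separating_hyperplane_sets[of N K] z by blast
  have \<beta>: "\<beta> \<le> 0" using a(3) convex_cone_contains_0[OF K] by force
  have aK: "0 \<le> a \<bullet> x" if "x \<in> K" for x
  proof (rule ccontr)
    assume neg: "\<not> 0 \<le> a \<bullet> x"
    have "((\<beta> - 1) / (a \<bullet> x)) *\<^sub>R x \<in> K"
      using \<beta> neg by (intro convex_cone_scaleR[OF K _ that]) (simp add: divide_nonpos_neg)
    with a(3) have "\<beta> \<le> a \<bullet> (((\<beta> - 1) / (a \<bullet> x)) *\<^sub>R x)" by blast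
    with neg show False by simp
  qed
  \<comment> \<open>The bound on \<open>N\<close> carries over to \<open>c \<bullet> x = 0\<close> because a large multiple of \<open>x\<close> stays in
      \<open>N\<close> after a shift by \<open>z\<close>.\<close>
  have aP: "a \<bullet> x \<le> 0" if "\<And>k. Q k \<bullet> x \<le> 0" "c \<bullet> x \<le> 0" for x
  proof (rule ccontr)
    assume "\<not> a \<bullet> x \<le> 0"
    then have pos: "0 < a \<bullet> x" by simp
    define t where "t = (\<bar>a \<bullet> z\<bar> + 1) / (a \<bullet> x)"
    have t: "0 \<le> t" using pos by (simp add: t_def)
    have "t *\<^sub>R x + z \<in> N"
      using z that t by (auto simp: N_def inner_add_right add_nonpos_nonpos mult_nonneg_nonpos
          intro!: add_nonpos_neg)
    with a(2) \<beta> have "a \<bullet> (t *\<^sub>R x + z) \<le> 0" by force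
    then have "\<bar>a \<bullet> z\<bar> + 1 + a \<bullet> z \<le> 0"
      using pos by (simp add: inner_add_right t_def)
    then show False by linarith
  qed
  define R where "R i = (case i of None \<Rightarrow> c | Some k \<Rightarrow> Q k)" for i
  have "a \<bullet> x \<le> 0" if "\<And>i. R i \<bullet> x \<le> 0" for x
    using that[of None] that[of "Some _"] by (intro aP) (simp_all add: R_def)
  then obtain \<nu> where \<nu>: "\<And>i. 0 \<le> \<nu> i" "a = (\<Sum>i\<in>UNIV. \<nu> i *\<^sub>R R i)"
    using farkas[of R a] by blast
  define \<tau> where "\<tau> = \<nu> None"
  have a_eq: "a = \<tau> *\<^sub>R c + (\<Sum>k\<in>UNIV. \<nu> (Some k) *\<^sub>R Q k)"
    by (simp add: \<nu>(2) sum_UNIV_option R_def \<tau>_def)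
  have "\<tau> \<noteq> 0"
  proof
    assume "\<tau> = 0"
    then have "a \<bullet> x0 = (\<Sum>k\<in>UNIV. \<nu> (Some k) * (Q k \<bullet> x0))"
      by (simp add: a_eq inner_sum_left)
    also have "\<dots> \<le> 0" by (intro sum_nonpos mult_nonneg_nonpos \<nu> x0)
    finally show False using inner_pos_of_interior[OF x0(1) a(1) aK] by simp
  qed
  then have \<tau>: "0 < \<tau>" using \<nu>(1)[of None] by (simp add: \<tau>_def)
  have "c + (\<Sum>k\<in>UNIV. (\<nu> (Some k) / \<tau>) *\<^sub>R Q k) = (1 / \<tau>) *\<^sub>R a"
    using \<tau> by (simp add: a_eq scaleR_add_right scaleR_sum_right)
  then show ?thesis
    using that[of "\<lambda>k. \<nu> (Some k) / \<tau>"] \<tau> \<nu>(1) aK by simp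
qed

section \<open>Positive definite matrices as interior points\<close>

lemma convex_cone_nonneg_forms: "convex_cone {X :: real^'a::finite^'a. \<forall>v. 0 \<le> X \<bullet> outer v}"
  by (simp add: convex_cone_iff inner_add_left)

text \<open>
  The cone of all matrices with nonnegative quadratic form, symmetric or not, has nonempty
  interior in the full matrix space; the semidefinite cone itself lies in a proper
  subspace.  By compactness of the unit sphere a positive definite form is bounded below by
  \<open>\<delta> * (norm v)\<^sup>2\<close>, so perturbations of norm less than \<open>\<delta>\<close> keep it nonnegative.
\<close>
lemma pos_def_interior:
  fixes X :: "real^'a::finite^'a"
  assumes "pos_def X"
  shows "X \<in> interior {X. \<forall>v. 0 \<le> X \<bullet> outer v}"
proof -
  let ?S = "sphere (0 :: real^'a) 1"
  have "continuous_on ?S (\<lambda>v. v \<bullet> (X *v v))"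
    by (intro continuous_intros linear_continuous_on) simp
  moreover have "axis undefined 1 \<in> ?S" by (simp add: norm_axis_1)
  ultimately obtain w where w: "w \<in> ?S" "\<And>v. v \<in> ?S \<Longrightarrow> X \<bullet> outer w \<le> X \<bullet> outer v"
    using continuous_attains_inf[of ?S "\<lambda>v. v \<bullet> (X *v v)"]
    unfolding quadratic_form_eq_inner_outer by (metis compact_sphere empty_iff)
  define \<delta> where "\<delta> = X \<bullet> outer w"
  have "w \<noteq> 0" using w(1) by auto
  with assms have \<delta>: "0 < \<delta>" by (simp add: pos_def_iff \<delta>_def)
  have "0 \<le> Y \<bullet> outer v" if Y: "Y \<in> ball X \<delta>" for Y v
  proof (cases "v = 0")
    case True
    then show ?thesis by (simp add: quadratic_form_eq_inner_outer[symmetric])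
  next
    case False
    have "\<delta> \<le> X \<bullet> outer (sgn v)"
      unfolding \<delta>_def using False by (intro w) (simp add: norm_sgn)
    moreover have "\<bar>(X - Y) \<bullet> outer (sgn v)\<bar> \<le> norm (X - Y)"
      using Cauchy_Schwarz_ineq2[of "X - Y" "outer (sgn v)"] False
      by (simp add: norm_outer norm_sgn)
    moreover have "norm (X - Y) < \<delta>" using Y by (simp add: dist_norm)
    ultimately have "0 \<le> Y \<bullet> outer (sgn v)" by (simp add: inner_diff_left)
    then have "0 \<le> (norm v)\<^sup>2 * (Y \<bullet> outer (sgn v))" by simp
    also have "\<dots> = Y \<bullet> outer (norm v *\<^sub>R sgn v)" by (simp add: outer_scaleR)
    also have "norm v *\<^sub>R sgn v = v" using False by (simp add: sgn_div_norm)
    finally show ?thesis .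
  qed
  then show ?thesis
    unfolding mem_interior using \<delta> by blast
qed

section \<open>Homogenization\<close>

lemma rank_one_lift_eq: "rank_one_lift u = outer (homogenize u)"
  by (simp add: rank_one_lift_def outer_def)

lemma inner_data_matrix_rank_one_lift:
  "data_matrix A b c \<bullet> rank_one_lift u = quad_fun A b c u"
  by (simp add: inner_vec_def sum_UNIV_option data_matrix_def rank_one_lift_def homogenize_def
      quad_fun_def matrix_vector_mult_def sum.distrib sum_distrib_left mult_ac)

lemma inner_H_mat: "H_mat \<bullet> X = X $ None $ None"
  by (simp add: inner_vec_def sum_UNIV_option H_mat_def)

lemma H_mat_eq_outer: "H_mat = outer (axis None 1)"
  by (auto simp: H_mat_def outer_def vec_eq_iff axis_def)

lemma inner_H_mat_rank_one_lift: "H_mat \<bullet> rank_one_lift u = 1"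
  by (simp add: inner_H_mat rank_one_lift_def homogenize_def)

lemma sym_mat_data_matrix: "sym_mat A \<Longrightarrow> sym_mat (data_matrix A b c)"
  by (auto simp: sym_mat_iff data_matrix_def split: option.splits)

text \<open>
  The vectors with nonzero coordinate \<open>None\<close> are multiples of homogenized points, and they are
  dense; this is why nonnegativity of a quadratic function on the affine space is the same
  as semidefiniteness of its matrix.
\<close>
lemma psd_iff_nonneg_homogenize:
  fixes Z :: "real^('n::finite option)^('n option)"
  assumes "sym_mat Z"
  shows "psd Z \<longleftrightarrow> (\<forall>u. 0 \<le> Z \<bullet> rank_one_lift u)"
proof
  assume "psd Z"
  then show "\<forall>u. 0 \<le> Z \<bullet> rank_one_lift u" by (simp add: psd_iff rank_one_lift_eq)
next
  assume lift: "\<forall>u. 0 \<le> Z \<bullet> rank_one_lift u"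
  have nz: "0 \<le> Z \<bullet> outer v" if "v $ None \<noteq> 0" for v
  proof -
    define u :: "real^'n" where "u = (\<chi> k. v $ Some k / v $ None)"
    have "v = (v $ None) *\<^sub>R homogenize u"
      using that by (simp add: vec_eq_iff homogenize_def u_def split: option.splits)
    then have "Z \<bullet> outer v = (v $ None)\<^sup>2 * (Z \<bullet> rank_one_lift u)"
      by (metis outer_scaleR inner_scaleR_right rank_one_lift_eq)
    then show ?thesis using lift by simp
  qed
  have "0 \<le> Z \<bullet> outer v" for v
  proof (cases "v $ None = 0")
    case True
    let ?e = "axis None 1 :: real^('n option)"
    let ?f = "\<lambda>t. Z \<bullet> outer v + 2 * t * (?e \<bullet> (Z *v v)) + t\<^sup>2 * (Z \<bullet> outer ?e)"
    have "(?f \<longlongrightarrow> ?f 0) (at_right 0)"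
      by (intro tendsto_intros)
    moreover have "0 \<le> ?f t" if "0 < t" for t
    proof -
      have "0 \<le> Z \<bullet> outer (v + t *\<^sub>R ?e)"
        by (rule nz) (use True that in simp)
      then show ?thesis by (simp add: inner_outer_add[OF assms])
    qed
    then have "\<forall>\<^sub>F t in at_right 0. 0 \<le> ?f t"
      by (auto simp: eventually_at_right_less eventually_at_filter)
    ultimately have "0 \<le> ?f 0"
      by (rule tendsto_lowerbound) simp
    then show ?thesis by simp
  qed (rule nz)
  then show "psd Z" using assms by (simp add: psd_iff)
qed

section \<open>The semidefinite relaxation and its dual\<close>

lemma primal_optimal_value:
  assumes "primal_optimal Q X"
  shows "primal_value Q = ereal (Q None \<bullet> X)"
  unfolding primal_value_def
  using assms by (intro antisym INF_lower INF_greatest) (auto simp: primal_optimal_def)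

lemma dual_optimal_value:
  assumes "dual_optimal Q y s"
  shows "dual_value Q = ereal s"
  unfolding dual_value_def
  using assms by (intro antisym SUP_least SUP_upper2[of "(y, s)"]) (auto simp: dual_optimal_def)

lemma weak_duality:
  assumes X: "X \<in> primal_feasible Q" and ys: "(y, s) \<in> dual_feasible Q"
  shows "s \<le> Q None \<bullet> X"
proof -
  let ?Z = "Q None + (\<Sum>k\<in>UNIV. y $ k *\<^sub>R Q (Some k)) - s *\<^sub>R H_mat"
  have y: "0 \<le> y $ k" and Z: "psd ?Z" for k
    using ys by (auto simp: dual_feasible_def nonneg_multipliers_def)
  have XF: "psd X" "Q (Some k) \<bullet> X \<le> 0" "H_mat \<bullet> X = 1" for k
    using X by (auto simp: primal_feasible_def F_tilde_def)
  have "0 \<le> ?Z \<bullet> X" by (rule psd_inner_nonneg[OF Z XF(1)])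
  also have "\<dots> = Q None \<bullet> X + (\<Sum>k\<in>UNIV. y $ k * (Q (Some k) \<bullet> X)) - s"
    by (simp add: inner_diff_left inner_add_left inner_sum_left XF)
  also have "(\<Sum>k\<in>UNIV. y $ k * (Q (Some k) \<bullet> X)) \<le> 0"
    by (intro sum_nonpos mult_nonneg_nonpos y XF)
  finally show ?thesis by simp
qed

lemma dual_value_le_primal_value: "dual_value Q \<le> primal_value Q"
  unfolding dual_value_def primal_value_def
  by (intro SUP_least INF_greatest) (auto intro: weak_duality)

lemma dual_optimal_if_tight:
  assumes "X \<in> primal_feasible Q" "(y, Q None \<bullet> X) \<in> dual_feasible Q"
  shows "primal_optimal Q X" "dual_optimal Q y (Q None \<bullet> X)"
  using assms weak_duality by (auto simp: primal_optimal_def dual_optimal_def)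

lemma inner_symmetric_part:
  fixes Y X :: "real^'a::finite^'a"
  assumes "sym_mat Y"
  shows "Y \<bullet> ((1/2) *\<^sub>R (X + transpose X)) = Y \<bullet> X"
proof -
  have "Y \<bullet> transpose X = (\<Sum>i\<in>UNIV. \<Sum>j\<in>UNIV. Y $ j $ i * X $ j $ i)"
    using assms by (simp add: inner_vec_def transpose_def sym_mat_iff)
  also have "\<dots> = Y \<bullet> X"
    by (subst sum.swap) (simp add: inner_vec_def)
  finally show ?thesis by (simp add: inner_add_right)
qed

text \<open>
  The constraint \<open>H_mat \<bullet> X = 1\<close> can be absorbed into the objective.  A semidefinite \<open>X\<close>
  satisfying the homogeneous constraints is either a multiple of a feasible matrix, or has
  \<open>H_mat \<bullet> X = 0\<close> and is a recession direction, along which an attained minimum cannot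
  decrease.
\<close>
lemma homogeneous_lower_bound:
  assumes opt: "primal_optimal Q Xs"
    and X: "psd X" "\<And>k. Q (Some k) \<bullet> X \<le> 0"
  shows "0 \<le> (Q None - (Q None \<bullet> Xs) *\<^sub>R H_mat) \<bullet> X"
proof -
  let ?p = "Q None \<bullet> Xs" and ?h = "H_mat \<bullet> X"
  have Xs: "psd Xs" "\<And>k. Q (Some k) \<bullet> Xs \<le> 0" "H_mat \<bullet> Xs = 1"
    and le: "\<And>X'. X' \<in> primal_feasible Q \<Longrightarrow> ?p \<le> Q None \<bullet> X'"
    using opt by (auto simp: primal_optimal_def primal_feasible_def F_tilde_def)
  have "0 \<le> ?h" using X(1) by (simp add: H_mat_eq_outer psd_iff inner_commute)
  then consider "0 < ?h" | "?h = 0" by linarith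
  then have "?p * ?h \<le> Q None \<bullet> X"
  proof cases
    case 1
    have "(1 / ?h) *\<^sub>R X \<in> primal_feasible Q"
      using 1 X by (auto simp: primal_feasible_def F_tilde_def psd_iff sym_mat_iff divide_nonpos_pos)
    from le[OF this] 1 show ?thesis by (simp add: field_simps)
  next
    case 2
    have "Xs + X \<in> primal_feasible Q"
      using 2 X Xs by (auto simp: primal_feasible_def F_tilde_def psd_iff sym_mat_iff
          inner_add_left inner_add_right add_nonpos_nonpos)
    from le[OF this] 2 show ?thesis by (simp add: inner_add_right)
  qed
  then show ?thesis by (simp add: inner_diff_left)
qed

text \<open>
  Multipliers for the objective \<open>Q None - p * H_mat\<close>, where \<open>p\<close> is the optimal value, are
  exactly dual feasible points with value \<open>p\<close>.  They are sought over the cone of all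
  matrices with nonnegative form, where \<open>X0\<close> is an interior point; replacing a matrix by
  its symmetric part changes none of the inner products, so \<open>homogeneous_lower_bound\<close>
  extends to that cone.  Testing on rank-one matrices then gives semidefiniteness.
\<close>
lemma strong_duality:
  fixes Q :: "'m::finite option \<Rightarrow> real^('n::finite option)^('n option)"
  assumes sym: "\<And>k. sym_mat (Q k)"
    and slater: "X0 \<in> F_tilde Q" "pos_def X0"
    and opt: "primal_optimal Q Xs"
  obtains y where "dual_optimal Q y (Q None \<bullet> Xs)"
proof -
  let ?p = "Q None \<bullet> Xs" and ?K = "{X :: real^('n option)^('n option). \<forall>v. 0 \<le> X \<bullet> outer v}"
  let ?c = "Q None - ?p *\<^sub>R H_mat"
  have symc: "sym_mat ?c"
    using sym[of None] by (auto simp: sym_mat_iff H_mat_def)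
  have nonneg: "0 \<le> ?c \<bullet> X" if X: "X \<in> ?K" "\<And>k. Q (Some k) \<bullet> X \<le> 0" for X
  proof -
    define S where "S = (1/2) *\<^sub>R (X + transpose X)"
    have S: "Y \<bullet> S = Y \<bullet> X" if "sym_mat Y" for Y
      unfolding S_def by (rule inner_symmetric_part[OF that])
    have "0 \<le> S \<bullet> outer v" for v
      using X(1) S[OF sym_mat_outer, of v] by (simp add: inner_commute)
    moreover have "sym_mat S" by (simp add: S_def sym_mat_iff transpose_def)
    ultimately have "psd S" by (simp add: psd_iff)
    moreover have "Q (Some k) \<bullet> S \<le> 0" for k
      using X(2)[of k] S[OF sym] by simp
    ultimately have "0 \<le> ?c \<bullet> S"
      by (rule homogeneous_lower_bound[OF opt])
    then show ?thesis by (simp only: S[OF symc])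
  qed
  have feas: "Q (Some k) \<bullet> X0 \<le> 0" for k
    using slater(1) by (simp add: F_tilde_def)
  obtain \<mu> where \<mu>: "\<And>k. 0 \<le> \<mu> k"
    "\<And>X. X \<in> ?K \<Longrightarrow> 0 \<le> (?c + (\<Sum>k\<in>UNIV. \<mu> k *\<^sub>R Q (Some k))) \<bullet> X"
  proof (rule conic_multipliers[where Q = "\<lambda>k. Q (Some k)" and c = ?c,
        OF convex_cone_nonneg_forms pos_def_interior[OF slater(2)] feas])
    show "0 \<le> ?c \<bullet> X" if "X \<in> ?K" "\<And>k. Q (Some k) \<bullet> X \<le> 0" for X
      using that by (rule nonneg)
  qed (rule that)
  define y :: "real^'m" where "y = (\<chi> k. \<mu> k)"
  let ?Z = "Q None + (\<Sum>k\<in>UNIV. y $ k *\<^sub>R Q (Some k)) - ?p *\<^sub>R H_mat"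
  have Z_eq: "?Z = ?c + (\<Sum>k\<in>UNIV. \<mu> k *\<^sub>R Q (Some k))" by (simp add: y_def)
  have "0 \<le> ?Z \<bullet> outer v" for v
    unfolding Z_eq by (rule \<mu>(2)) (simp add: inner_outer_outer)
  moreover have "sym_mat ?Z"
    using sym by (auto simp: sym_mat_iff H_mat_def)
  ultimately have "(y, ?p) \<in> dual_feasible Q"
    using \<mu>(1) by (simp add: dual_feasible_def nonneg_multipliers_def psd_iff y_def)
  then show ?thesis
    using that dual_optimal_if_tight(2) opt unfolding primal_optimal_def by blast
qed

section \<open>Quadratically constrained quadratic programs\<close>

locale qcqp =
  fixes A :: "'m::finite option \<Rightarrow> real^'n::finite^'n"
    and b :: "'m option \<Rightarrow> real^'n"
    and c :: "'m option \<Rightarrow> real"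
  assumes sym_A: "sym_mat (A k)"
begin

abbreviation "q \<equiv> (\<lambda>k. quad_fun (A k) (b k) (c k))"
abbreviation "Q \<equiv> (\<lambda>k. data_matrix (A k) (b k) (c k))"

lemma sym_Q: "sym_mat (Q k)"
  by (rule sym_mat_data_matrix[OF sym_A])

lemma rank_one_lift_primal_feasible_iff:
  "rank_one_lift u \<in> primal_feasible Q \<longleftrightarrow> u \<in> qcqp_feasible q"
  using psd_outer[of "homogenize u"]
  by (auto simp: primal_feasible_def F_tilde_def qcqp_feasible_def inner_data_matrix_rank_one_lift
      inner_H_mat_rank_one_lift rank_one_lift_eq psd_iff simp flip: rank_one_lift_eq)

lemma dual_feasible_iff:
  "(y, s) \<in> dual_feasible Q \<longleftrightarrow> y \<in> nonneg_multipliers \<and> (\<forall>u. s \<le> lagrangian q u y)"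
proof -
  let ?Z = "Q None + (\<Sum>k\<in>UNIV. y $ k *\<^sub>R Q (Some k)) - s *\<^sub>R H_mat"
  have "sym_mat ?Z"
    using sym_Q by (auto simp: sym_mat_iff H_mat_def)
  moreover have "?Z \<bullet> rank_one_lift u = lagrangian q u y - s" for u
    by (simp add: inner_diff_left inner_add_left inner_sum_left inner_data_matrix_rank_one_lift
        inner_H_mat_rank_one_lift lagrangian_def)
  ultimately show ?thesis
    by (simp add: dual_feasible_def psd_iff_nonneg_homogenize)
qed

lemma primal_value_le: "primal_value Q \<le> qcqp_value q"
  unfolding qcqp_value_def
proof (rule INF_greatest)
  fix u assume "u \<in> qcqp_feasible q"
  then show "primal_value Q \<le> ereal (q None u)"
    unfolding primal_value_def
    by (intro INF_lower2[of "rank_one_lift u"])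
      (simp_all add: rank_one_lift_primal_feasible_iff inner_data_matrix_rank_one_lift)
qed

text \<open>
  For fixed \<open>y\<close> the semidefinite dual maximizes over all lower bounds \<open>s\<close> of the
  Lagrangian, so the two suprema agree; a Lagrangian unbounded below contributes
  \<open>-\<infinity>\<close> on one side and no \<open>s\<close> on the other.
\<close>
lemma dual_value_eq_lagrangian_dual_value: "dual_value Q = lagrangian_dual_value q"
proof (rule antisym)
  show "dual_value Q \<le> lagrangian_dual_value q"
    unfolding dual_value_def
  proof (rule SUP_least, clarify)
    fix y s assume "(y, s) \<in> dual_feasible Q"
    then show "ereal s \<le> lagrangian_dual_value q"
      unfolding lagrangian_dual_value_def
      by (intro SUP_upper2[of y] INF_greatest) (auto simp: dual_feasible_iff)
  qed
  show "lagrangian_dual_value q \<le> dual_value Q"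
    unfolding lagrangian_dual_value_def
  proof (rule SUP_least)
    fix y :: "real^'m" assume y: "y \<in> nonneg_multipliers"
    have le: "(INF u. ereal (lagrangian q u y)) \<le> ereal (lagrangian q u y)" for u
      by (rule INF_lower) simp
    show "(INF u. ereal (lagrangian q u y)) \<le> dual_value Q"
    proof (cases "INF u. ereal (lagrangian q u y)")
      case (real s)
      with le have "(y, s) \<in> dual_feasible Q"
        by (simp add: dual_feasible_iff y)
      then show ?thesis
        unfolding real dual_value_def by (intro SUP_upper2[of "(y, s)"]) auto
    next
      case PInf
      with le show ?thesis by simp
    next
      case MInf
      then show ?thesis by simp
    qed
  qed
qed

text \<open>
  A saddle point is a feasible point together with a multiplier that certifies it: raising
  one multiplier forces feasibility, and the zero multiplier gives the reverse bound
  \<open>q None u \<le> L(u,y)\<close>.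
\<close>
lemma saddle_point_iff:
  "saddle_point q u y \<longleftrightarrow> u \<in> qcqp_feasible q \<and> (y, q None u) \<in> dual_feasible Q"
proof
  assume sp: "saddle_point q u y"
  then have y: "y \<in> nonneg_multipliers"
    and sup: "(SUP y'\<in>nonneg_multipliers. ereal (lagrangian q u y')) = ereal (lagrangian q u y)"
    and inf: "ereal (lagrangian q u y) = (INF u'. ereal (lagrangian q u' y))"
    unfolding saddle_point_def by blast+
  have max: "lagrangian q u y' \<le> lagrangian q u y" if "y' \<in> nonneg_multipliers" for y'
  proof -
    have "ereal (lagrangian q u y') \<le> (SUP y'\<in>nonneg_multipliers. ereal (lagrangian q u y'))"
      using that by (rule SUP_upper)
    also note sup
    finally show ?thesis by simp
  qed
  have min: "lagrangian q u y \<le> lagrangian q u' y" for u'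
  proof -
    note inf
    also have "(INF u'. ereal (lagrangian q u' y)) \<le> ereal (lagrangian q u' y)"
      by (rule INF_lower) simp
    finally show ?thesis by simp
  qed
  have "q (Some k) u \<le> 0" for k
  proof -
    have "y + axis k 1 \<in> nonneg_multipliers"
      using y by (auto simp: nonneg_multipliers_def axis_def)
    moreover have "lagrangian q u (y + axis k 1) = lagrangian q u y + q (Some k) u"
      by (simp add: lagrangian_def distrib_right sum.distrib axis_def if_distrib[of "\<lambda>t. t * _"]
          cong: if_cong)
    ultimately show ?thesis using max by force
  qed
  moreover have "q None u \<le> lagrangian q u y"
    using max[of 0] by (simp add: nonneg_multipliers_def lagrangian_def)
  ultimately show "u \<in> qcqp_feasible q \<and> (y, q None u) \<in> dual_feasible Q"
    using y min by (force simp: qcqp_feasible_def dual_feasible_iff intro: order_trans)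
next
  assume asm: "u \<in> qcqp_feasible q \<and> (y, q None u) \<in> dual_feasible Q"
  then have y: "y \<in> nonneg_multipliers" and lower: "\<And>u'. q None u \<le> lagrangian q u' y"
    by (auto simp: dual_feasible_iff)
  have upper: "lagrangian q u y' \<le> q None u" if "y' \<in> nonneg_multipliers" for y'
  proof -
    have "(\<Sum>k\<in>UNIV. y' $ k * q (Some k) u) \<le> 0"
      using asm that
      by (intro sum_nonpos mult_nonneg_nonpos) (auto simp: nonneg_multipliers_def qcqp_feasible_def)
    then show ?thesis by (simp add: lagrangian_def)
  qed
  have eq: "lagrangian q u y = q None u" using upper[OF y] lower by (intro antisym)
  show "saddle_point q u y"
    unfolding saddle_point_def eq
  proof (intro conjI y)
    show "(SUP y'\<in>nonneg_multipliers. ereal (lagrangian q u y')) = ereal (q None u)"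
      using upper y eq by (intro antisym SUP_least SUP_upper2[of y]) auto
    show "ereal (q None u) = (INF u'. ereal (lagrangian q u' y))"
      using lower eq by (intro antisym INF_greatest INF_lower2[of u]) auto
  qed
qed

lemma saddle_point_iff_exact:
  "(\<exists>u y. saddle_point q u y) \<longleftrightarrow>
     primal_exact Q \<and> (\<exists>y s. dual_optimal Q y s) \<and> dual_value Q = primal_value Q"
proof
  assume "\<exists>u y. saddle_point q u y"
  then obtain u y where
    "rank_one_lift u \<in> primal_feasible Q" "(y, Q None \<bullet> rank_one_lift u) \<in> dual_feasible Q"
    by (auto simp: saddle_point_iff rank_one_lift_primal_feasible_iff
        inner_data_matrix_rank_one_lift)
  note opt = dual_optimal_if_tight[OF this]
  then have "dual_value Q = primal_value Q"
    by (simp only: primal_optimal_value dual_optimal_value)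
  with opt show "primal_exact Q \<and> (\<exists>y s. dual_optimal Q y s) \<and> dual_value Q = primal_value Q"
    unfolding primal_exact_def by blast
next
  assume "primal_exact Q \<and> (\<exists>y s. dual_optimal Q y s) \<and> dual_value Q = primal_value Q"
  then obtain u y s where opt: "primal_optimal Q (rank_one_lift u)" "dual_optimal Q y s"
    and eq: "dual_value Q = primal_value Q"
    unfolding primal_exact_def by blast
  have "s = q None u"
    using eq primal_optimal_value[OF opt(1)] dual_optimal_value[OF opt(2)]
    by (simp add: inner_data_matrix_rank_one_lift)
  with opt have "saddle_point q u y"
    by (simp add: saddle_point_iff primal_optimal_def dual_optimal_def
        rank_one_lift_primal_feasible_iff)
  then show "\<exists>u y. saddle_point q u y" by blast
qed

lemma exact_imp_dual_attained:
  assumes "generalized_slater Q" "primal_exact Q"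
  shows "(\<exists>y s. dual_optimal Q y s) \<and> dual_value Q = primal_value Q"
proof -
  obtain X0 where X0: "X0 \<in> F_tilde Q" "pos_def X0"
    using assms(1) by (auto simp: generalized_slater_def)
  obtain X where X: "primal_optimal Q X"
    using assms(2) by (auto simp: primal_exact_def)
  obtain y where "dual_optimal Q y (Q None \<bullet> X)"
    by (rule strong_duality[OF sym_Q X0 X])
  then show ?thesis
    by (auto simp only: primal_optimal_value[OF X] dual_optimal_value)
qed

lemma exact_imp_value_eq:
  assumes "primal_exact Q"
  shows "-\<infinity> < primal_value Q \<and> primal_value Q = qcqp_value q \<and> qcqp_value q < \<infinity>"
proof -
  obtain u where opt: "primal_optimal Q (rank_one_lift u)"
    using assms by (auto simp: primal_exact_def)
  have val: "primal_value Q = ereal (q None u)"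
    using primal_optimal_value[OF opt] by (simp add: inner_data_matrix_rank_one_lift)
  have "qcqp_value q \<le> ereal (q None u)"
    unfolding qcqp_value_def using opt
    by (intro INF_lower) (simp add: primal_optimal_def rank_one_lift_primal_feasible_iff)
  with primal_value_le val have "qcqp_value q = ereal (q None u)" by (metis antisym)
  with val show ?thesis by simp
qed

lemma value_eq_imp_exact:
  assumes u: "qcqp_minimizer q u" and eq: "primal_value Q = qcqp_value q"
  shows "primal_exact Q"
proof -
  let ?X = "rank_one_lift u"
  have "qcqp_value q = ereal (q None u)"
    unfolding qcqp_value_def
    using u by (intro antisym INF_lower INF_greatest) (auto simp: qcqp_minimizer_def)
  then have val: "primal_value Q = ereal (Q None \<bullet> ?X)"
    by (simp only: eq inner_data_matrix_rank_one_lift)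
  have "Q None \<bullet> ?X \<le> Q None \<bullet> X" if "X \<in> primal_feasible Q" for X
  proof -
    have "primal_value Q \<le> ereal (Q None \<bullet> X)"
      unfolding primal_value_def using that by (rule INF_lower)
    then show ?thesis by (simp only: val ereal_less_eq)
  qed
  moreover have "?X \<in> primal_feasible Q"
    using u by (simp only: rank_one_lift_primal_feasible_iff qcqp_minimizer_def)
  ultimately show ?thesis
    unfolding primal_exact_def primal_optimal_def by blast
qed

end

theorem mainTheorem1:
  fixes A :: "'m::finite option \<Rightarrow> real^'n::finite^'n"
    and b :: "'m option \<Rightarrow> real^'n"
    and c :: "'m option \<Rightarrow> real"
  assumes "\<And>k. sym_mat (A k)"
    and "c None = 0"
  shows "let
      q = (\<lambda>k. quad_fun (A k) (b k) (c k));
      Q = (\<lambda>k. data_matrix (A k) (b k) (c k));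
      \<zeta> = qcqp_value q;
      \<eta>p = primal_value Q;
      \<eta>d = dual_value Q;
      \<phi> = lagrangian_dual_value q;
      condA = (\<exists>u y. saddle_point q u y);
      condB = (primal_exact Q \<and> (\<exists>y s. dual_optimal Q y s) \<and> \<eta>d = \<eta>p);
      condC = primal_exact Q;
      condD = (-\<infinity> < \<eta>p \<and> \<eta>p = \<zeta> \<and> \<zeta> < \<infinity>);
      condE = (-\<infinity> < \<eta>d \<and> \<eta>d = \<zeta> \<and> \<zeta> < \<infinity>);
      condF = (-\<infinity> < \<phi> \<and> \<phi> = \<zeta> \<and> \<zeta> < \<infinity>);
      asm_a = generalized_slater Q;
      asm_b = (-\<infinity> < \<zeta> \<and> \<zeta> < \<infinity> \<longrightarrow> (\<exists>u. qcqp_minimizer q u))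
    in
      (condA \<longleftrightarrow> condB) \<and>
      ((condB \<longrightarrow> condC) \<and> (asm_a \<longrightarrow> condC \<longrightarrow> condB)) \<and>
      ((condC \<longrightarrow> condD) \<and> (asm_b \<longrightarrow> condD \<longrightarrow> condC)) \<and>
      ((condE \<longrightarrow> condD) \<and> (condB \<longrightarrow> condD \<longrightarrow> condE)) \<and>
      (condE \<longleftrightarrow> condF) \<and>
      (asm_a \<and> asm_b \<longrightarrow>
        (condA \<longleftrightarrow> condB) \<and> (condB \<longleftrightarrow> condC) \<and> (condC \<longleftrightarrow> condD) \<and>
        (condD \<longleftrightarrow> condE) \<and> (condE \<longleftrightarrow> condF))"
proof -
  interpret qcqp A b c by unfold_locales (rule assms)
  let ?C = "primal_exact Q"
  let ?B = "?C \<and> (\<exists>y s. dual_optimal Q y s) \<and> dual_value Q = primal_value Q"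
  let ?D = "-\<infinity> < primal_value Q \<and> primal_value Q = qcqp_value q \<and> qcqp_value q < \<infinity>"
  let ?E = "-\<infinity> < dual_value Q \<and> dual_value Q = qcqp_value q \<and> qcqp_value q < \<infinity>"
  let ?b = "-\<infinity> < qcqp_value q \<and> qcqp_value q < \<infinity> \<longrightarrow> (\<exists>u. qcqp_minimizer q u)"
  have aCB: "generalized_slater Q \<longrightarrow> ?C \<longrightarrow> ?B"
    using exact_imp_dual_attained by blast
  have CD: "?C \<longrightarrow> ?D"
    using exact_imp_value_eq by blast
  have bDC: "?b \<longrightarrow> ?D \<longrightarrow> ?C"
  proof (intro impI)
    assume b: ?b and D: ?D
    then have "-\<infinity> < qcqp_value q" by (elim conjE) (simp only:)
    with b D obtain u where "qcqp_minimizer q u" by blast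
    with D show ?C using value_eq_imp_exact by blast
  qed
  have ED: "?E \<longrightarrow> ?D"
  proof
    assume E: ?E
    then have "qcqp_value q \<le> primal_value Q"
      using dual_value_le_primal_value[of Q] by (elim conjE) (simp only:)
    then have "primal_value Q = qcqp_value q"
      using primal_value_le by (intro antisym)
    with E show ?D by (elim conjE) (simp only: simp_thms)
  qed
  have BDE: "?B \<longrightarrow> ?D \<longrightarrow> ?E"
  proof (intro impI)
    assume ?B ?D
    then show ?E by (elim conjE) (simp only: simp_thms)
  qed
  \<comment> \<open>Rewriting turns (A) into (B) and (F) into (E); what remains is propositional.\<close>
  have glue: "(B = B) \<and> ((B \<longrightarrow> C) \<and> (a \<longrightarrow> C \<longrightarrow> B)) \<and> ((C \<longrightarrow> D) \<and> (b \<longrightarrow> D \<longrightarrow> C)) \<and>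
      ((E \<longrightarrow> D) \<and> (B \<longrightarrow> D \<longrightarrow> E)) \<and> (E = E) \<and>
      (a \<and> b \<longrightarrow> (B = B) \<and> (B = C) \<and> (C = D) \<and> (D = E) \<and> (E = E))"
    if "B \<longrightarrow> C" "a \<longrightarrow> C \<longrightarrow> B" "C \<longrightarrow> D" "b \<longrightarrow> D \<longrightarrow> C" "E \<longrightarrow> D" "B \<longrightarrow> D \<longrightarrow> E" for B C D E a b
    using that by argo
  show ?thesis
    unfolding Let_def saddle_point_iff_exact dual_value_eq_lagrangian_dual_value[symmetric]
    by (rule glue[OF _ aCB CD bDC ED BDE]) (rule impI, erule conjunct1)
qed

end
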